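(* For any odd prime $p$ with $p\equiv 3 \bmod 4$, we have $$A(p)=\sum_{a=1}^{\frac{p-1}{2}}\left(\frac{a}{p}\right)>0,$$ where $\left(\frac{a}{p}\right)$ denotes the Legendre symbol modulo $p$.
   Context: For an odd prime $p$ and an integer $a$, the Legendre symbol $\left(\frac{a}{p}\right)$ equals $1$ if $a$ is a quadratic residue modulo $p$ (with $p\nmid a$), $-1$ if $a$ is a quadratic non-residue modulo $p$, and $0$ if $a\equiv 0 \bmod p$. The sum $A(p)$ is an integer. *)

theory Defs
  imports "HOL-Number_Theory.Number_Theory"
begin

end

(*
  Let G be the imaginary part of the quadratic Gauss sum; its real part vanishes.  Orthogonality
  gives G^2 = p, and G = 2 * (sum of sin (2 pi r^2 / p) over 0 < r < p / 2).  Away from the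
  endpoints r = 0 and r = p / 2 the latter sum is estimated by summation by parts
  (Kusmin--Landau), near the endpoints its terms are positive; for p >= 25 this yields
  G > - sqrt p and hence G = sqrt p.  For smaller p, enough squares lie below p / 2.

  The divisor sums of the Legendre symbol are nonnegative, so the partial sums of
  L(1) = sum of chi(n) / n are bounded below by -C / n.  By Abel summation and the expansion of
  Im Ln (1 - r e^(it)), the limit of G * (sum of chi(n) r^n / n) for r -> 1 equals
  -(pi / p) T with T = sum of a chi(a) over 0 < a < p, so T <= 0.  Finally
  p A(p) = (chi(2) - 2) T >= 0, and A(p) is a sum of an odd number of odd terms.
*)
theory Submission
  imports Defs "HOL-Analysis.Complex_Transcendental" "HOL-Real_Asymp.Real_Asymp"
begin

section \<open>Exponential sums with quadratic phase\<close>

text \<open>Summation by parts: the coefficients fall by \<open>c 0 - c (N - 1)\<close> in total,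
  and the boundary terms cost \<open>c 0\<close> and \<open>c (N - 1)\<close>. The induction works
  with the last boundary term split off, so that each further coefficient contributes exactly its
  decrease.\<close>

lemma norm_sum_decreasing_scaleR_diff_le:
  fixes E :: "nat \<Rightarrow> 'a::real_normed_vector" and c :: "nat \<Rightarrow> real"
  assumes dec: "\<And>j. Suc j < N \<Longrightarrow> c (Suc j) \<le> c j"
    and nonneg: "\<And>j. j < N \<Longrightarrow> 0 \<le> c j"
    and E: "\<And>j. norm (E j) \<le> 1" and "0 < N"
  shows "norm (\<Sum>j<N. c j *\<^sub>R (E (Suc j) - E j)) \<le> 2 * c 0"
proof -
  have *: "norm ((\<Sum>j<Suc n. c j *\<^sub>R (E (Suc j) - E j)) - c n *\<^sub>R E (Suc n)) \<le> 2 * c 0 - c n"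
    if "n < N" for n
    using that
  proof (induction n)
    case 0
    then show ?case using mult_left_mono[OF E[of 0] nonneg[of 0]] nonneg[of 0]
      by (simp add: scaleR_right_diff_distrib)
  next
    case (Suc n)
    let ?S = "\<lambda>n. (\<Sum>j<Suc n. c j *\<^sub>R (E (Suc j) - E j)) - c n *\<^sub>R E (Suc n)"
    have "?S (Suc n) = ?S n + (c n - c (Suc n)) *\<^sub>R E (Suc n)"
      by (simp add: algebra_simps)
    also have "norm \<dots> \<le> norm (?S n) + norm ((c n - c (Suc n)) *\<^sub>R E (Suc n))"
      by (rule norm_triangle_ineq)
    also have "\<dots> \<le> (2 * c 0 - c n) + (c n - c (Suc n)) * 1"
      using Suc dec[of n] mult_left_mono[OF E[of "Suc n"], of "c n - c (Suc n)"]
      by (intro add_mono) auto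
    finally show ?case by simp
  qed
  obtain n where n: "N = Suc n" using \<open>0 < N\<close> gr0_implies_Suc by blast
  have "norm (\<Sum>j<N. c j *\<^sub>R (E (Suc j) - E j))
      \<le> norm ((\<Sum>j<N. c j *\<^sub>R (E (Suc j) - E j)) - c n *\<^sub>R E (Suc n)) + norm (c n *\<^sub>R E (Suc n))"
    by (metis diff_add_cancel norm_triangle_ineq)
  also have "\<dots> \<le> (2 * c 0 - c n) + c n * 1"
    using *[of n] n mult_left_mono[OF E[of "Suc n"] nonneg[of n]] nonneg[of n]
    by (intro add_mono) auto
  finally show ?thesis by simp
qed

lemma cis_add_minus_cis_diff: "cis (x + y) - cis (x - y) = 2 * \<i> * sin y * cis x"
  by (simp add: complex_eq_iff cos_add sin_add cos_diff sin_diff)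

text \<open>Kusmin--Landau for a quadratic phase. Up to a constant factor of norm 2, each term is
  the difference of \<open>E\<close> at the neighbouring half-steps, weighted by \<open>c j\<close>.
  The weights decrease because the angles stay in the first quadrant, so summation by parts bounds
  the sum by its first weight.\<close>

lemma norm_sum_cis_square_le:
  fixes k x :: real
  assumes "0 < k" "0 < x" "0 < N" and le: "\<And>j. j < N \<Longrightarrow> x + real j \<le> k / 4"
  shows "norm (\<Sum>j<N. cis (2 * pi * (x + real j)\<^sup>2 / k)) \<le> 1 / sin (2 * pi * x / k)"
proof -
  define c where "c = (\<lambda>j. 1 / sin (2 * pi * (x + real j) / k))"
  define E where "E = (\<lambda>j. cis (2 * pi * (x + real j - 1/2)\<^sup>2 / k))"
  have arg: "0 < 2 * pi * (x + real j) / k" "2 * pi * (x + real j) / k \<le> pi / 2" if "j < N" for j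
  proof -
    show "0 < 2 * pi * (x + real j) / k" using assms(1,2) by (simp add: add_pos_nonneg)
    have "2 * pi * (x + real j) / k \<le> 2 * pi * (k / 4) / k"
      using le[OF that] assms(1) by (intro divide_right_mono mult_left_mono) auto
    then show "2 * pi * (x + real j) / k \<le> pi / 2" using assms(1) by simp
  qed
  have pos: "0 < sin (2 * pi * (x + real j) / k)" if "j < N" for j
    using arg[OF that] pi_half_less_two pi_gt_zero by (intro sin_gt_zero) auto
  have step: "c j *\<^sub>R (E (Suc j) - E j)
      = 2 * \<i> * cis (pi / (2 * k)) * cis (2 * pi * (x + real j)\<^sup>2 / k)" if "j < N" for j
  proof -
    \<comment> \<open>Mean and half the difference of the phases of \<open>E (Suc j)\<close> and
      \<open>E j\<close>.\<close>
    let ?m = "2 * pi * (x + real j)\<^sup>2 / k + pi / (2 * k)" and ?d = "2 * pi * (x + real j) / k"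
    have "(x + real (Suc j) - 1/2)\<^sup>2 = (x + real j)\<^sup>2 + 1/4 + (x + real j)"
      "(x + real j - 1/2)\<^sup>2 = (x + real j)\<^sup>2 + 1/4 - (x + real j)"
      by (simp_all add: power2_eq_square algebra_simps)
    then have "E (Suc j) = cis (?m + ?d)" "E j = cis (?m - ?d)"
      unfolding E_def by (simp_all add: ring_distribs add_divide_distrib diff_divide_distrib)
    then have "E (Suc j) - E j = 2 * \<i> * sin ?d * cis ?m"
      by (simp add: cis_add_minus_cis_diff)
    then show ?thesis using pos[OF that]
      by (simp add: c_def scaleR_conv_of_real cis_mult[symmetric] add.commute)
  qed
  have "norm (\<Sum>j<N. c j *\<^sub>R (E (Suc j) - E j)) \<le> 2 * c 0"
  proof (rule norm_sum_decreasing_scaleR_diff_le)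
    show "c (Suc j) \<le> c j" if "Suc j < N" for j
    proof -
      have "2 * pi * (x + real j) / k \<le> 2 * pi * (x + real (Suc j)) / k"
        using assms(1) by (intro divide_right_mono mult_left_mono) auto
      then have "sin (2 * pi * (x + real j) / k) \<le> sin (2 * pi * (x + real (Suc j)) / k)"
        using arg[of j] arg[of "Suc j"] that by (intro sin_monotone_2pi_le) auto
      then show ?thesis
        unfolding c_def using pos[of j] that by (intro divide_left_mono) auto
    qed
    show "0 \<le> c j" if "j < N" for j
      unfolding c_def using pos[OF that] by simp
  qed (use assms in \<open>auto simp: E_def\<close>)
  moreover have "(\<Sum>j<N. c j *\<^sub>R (E (Suc j) - E j))
      = 2 * \<i> * cis (pi / (2 * k)) * (\<Sum>j<N. cis (2 * pi * (x + real j)\<^sup>2 / k))"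
    using step by (simp add: sum_distrib_left)
  ultimately show ?thesis by (simp add: norm_mult c_def)
qed

lemma sum_lessThan_add:
  fixes f :: "nat \<Rightarrow> 'a::comm_monoid_add"
  shows "(\<Sum>j<n + d. f j) = (\<Sum>j<n. f j) + (\<Sum>j<d. f (n + j))"
  by (induction d) (simp_all add: add.assoc)

section \<open>Lower bounds for sums of sines and cosines at square phases\<close>

lemma sin_ge_cubic:
  fixes x :: real
  assumes "0 \<le> x"
  shows "x * (1 - x\<^sup>2 / 6) \<le> sin x"
proof -
  have "\<bar>sin x - x\<bar> \<le> x ^ 3 / 6"
    using Maclaurin_sin_bound[of x 3] assms
    by (simp add: sin_coeff_def numeral_eq_Suc field_simps)
  then have "- (sin x - x) \<le> x ^ 3 / 6" by (rule abs_le_D2)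
  then show ?thesis by (simp add: power2_eq_square power3_eq_cube algebra_simps)
qed

lemma cos_ge_quadratic: "1 - x\<^sup>2 / 2 \<le> cos x" for x :: real
proof -
  have "(sin (x / 2))\<^sup>2 \<le> (x / 2)\<^sup>2"
    using abs_sin_x_le_abs_x[of "x / 2"] by (metis abs_le_square_iff)
  moreover have "cos x = 1 - 2 * (sin (x / 2))\<^sup>2"
    using cos_double_sin[of "x / 2"] by simp
  ultimately show ?thesis by (simp add: power_divide)
qed

lemma pi_squared_less: "pi\<^sup>2 < 10"
proof -
  have "pi\<^sup>2 \<le> 3.15\<^sup>2" using pi_approx by (intro power_mono) auto
  then show ?thesis by (simp add: power2_eq_square)
qed

text \<open>Terms with phase at most pi are nonnegative. The remaining tail starts just beyond
  \<open>sqrt (k / 2)\<close>, where the sine in the Kusmin--Landau bound is at least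
  \<open>3.8 / sqrt k\<close>; the constant is 5/19 = 1/3.8.\<close>

lemma sum_sin_square_ge:
  fixes k :: real
  assumes k: "25 \<le> k" and m: "real m \<le> k / 4"
  shows "- (5 / 19) * sqrt k \<le> (\<Sum>j<m. sin (2 * pi * (1 + real j)\<^sup>2 / k))"
proof -
  define f where "f = (\<lambda>j. sin (2 * pi * (1 + real j)\<^sup>2 / k))"
  \<comment> \<open>The number of terms whose phase does not exceed pi.\<close>
  define n where "n = nat \<lfloor>sqrt (k / 2)\<rfloor>"
  have n: "real n \<le> sqrt (k / 2)" "sqrt (k / 2) < real n + 1"
    using k unfolding n_def by auto
  have q: "5 \<le> sqrt k" using k by (simp add: real_le_rsqrt)
  have head: "0 \<le> f j" if "j < n" for j
  proof -
    have "(1 + real j)\<^sup>2 \<le> (sqrt (k / 2))\<^sup>2"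
      using that n(1) by (intro power_mono) auto
    then have "2 * pi * (1 + real j)\<^sup>2 / k \<le> 2 * pi * (k / 2) / k"
      using k by (intro divide_right_mono mult_left_mono) auto
    then show ?thesis unfolding f_def using k by (intro sin_ge_zero) auto
  qed
  have "- (5 / 19) * sqrt k \<le> (\<Sum>j<m. f j)"
  proof (cases "m \<le> n")
    case True
    then have "0 \<le> (\<Sum>j<m. f j)" using head by (intro sum_nonneg) auto
    then show ?thesis using q by simp
  next
    case False
    define d where "d = m - n"
    have d: "m = n + d" "0 < d" using False by (auto simp: d_def)
    let ?x = "1 + real n"
    \<comment> \<open>The angle \<open>2 * pi * z / k\<close> at \<open>z = sqrt (k / 2)\<close>, a
      lower bound for the angle at the first tail term. Its square is 2 pi^2 / k, at most
      20/25.\<close>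
    define y where "y = sqrt 2 * pi / sqrt k"
    have y: "0 < y" using k by (simp add: y_def)
    have y2: "y\<^sup>2 \<le> 0.8"
      using k pi_squared_less by (simp add: y_def power_divide power_mult_distrib field_simps)
    have "1.41 \<le> sqrt 2" by (rule real_le_rsqrt) (simp add: power2_eq_square)
    then have "1.41 * 3.14 / sqrt k \<le> y"
      unfolding y_def using k pi_approx by (intro divide_right_mono mult_mono) auto
    then have "1.41 * 3.14 / sqrt k * (1 - 0.8 / 6) \<le> y * (1 - y\<^sup>2 / 6)"
      using y y2 by (intro mult_mono) auto
    also have "\<dots> \<le> sin y" using y by (intro sin_ge_cubic) auto
    finally have "95927 / 25000 / sqrt k \<le> sin y" by simp
    moreover have "3.8 / sqrt k \<le> 95927 / 25000 / sqrt k"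
      using k by (intro divide_right_mono) auto
    ultimately have "3.8 / sqrt k \<le> sin y" by simp
    moreover have "sin y \<le> sin (2 * pi * ?x / k)"
    proof (intro sin_monotone_2pi_le)
      have "2 * pi * ?x / k \<le> 2 * pi * (k / 4) / k"
        using d m k by (intro divide_right_mono mult_left_mono) auto
      then show "2 * pi * ?x / k \<le> pi / 2" using k by simp
      have "y = 2 * pi * sqrt (k / 2) / k"
        using k by (simp add: y_def real_sqrt_divide field_simps)
      also have "\<dots> \<le> 2 * pi * ?x / k"
        using n k by (intro divide_right_mono mult_left_mono) auto
      finally show "y \<le> 2 * pi * ?x / k" .
      show "- (pi / 2) \<le> y" using y pi_gt_zero by linarith
    qed
    ultimately have s: "3.8 / sqrt k \<le> sin (2 * pi * ?x / k)" by simp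
    have "(\<Sum>j<d. f (n + j)) = Im (\<Sum>j<d. cis (2 * pi * (?x + real j)\<^sup>2 / k))"
      by (simp add: f_def add.assoc)
    also have "\<bar>\<dots>\<bar> \<le> norm (\<Sum>j<d. cis (2 * pi * (?x + real j)\<^sup>2 / k))"
      by (rule abs_Im_le_cmod)
    also have "\<dots> \<le> 1 / sin (2 * pi * ?x / k)"
      using k m d by (intro norm_sum_cis_square_le) auto
    also have "\<dots> \<le> 1 / (3.8 / sqrt k)"
      using s k less_le_trans[OF _ s, of 0] by (intro divide_left_mono mult_pos_pos) auto
    finally have "\<bar>\<Sum>j<d. f (n + j)\<bar> \<le> 5 / 19 * sqrt k" by simp
    moreover have "0 \<le> (\<Sum>j<n. f j)" using head by (intro sum_nonneg) auto
    ultimately show ?thesis unfolding d sum_lessThan_add by simp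
  qed
  then show ?thesis by (simp add: f_def)
qed

lemma sum_odd_squares: "(\<Sum>j<n. (2 * real j + 1)\<^sup>2) = real n * (4 * (real n)\<^sup>2 - 1) / 3"
  by (induction n) (simp_all add: power2_eq_square algebra_simps)

text \<open>While the phase is at most pi/2, the quadratic bound for the cosine reduces the head to
  a sum of odd squares, which gives the terms 7/24 and 17/24. The tail costs at most 10/29 = 1/2.9
  times \<open>sqrt k\<close> by Kusmin--Landau, its first angle being at least
  \<open>pi / sqrt k\<close>.\<close>

lemma sum_cos_square_ge:
  fixes k :: real
  assumes k: "25 \<le> k" and km: "k = 4 * real m + 3"
  shows "7 / 24 * sqrt k - 17 / 24 - 10 / 29 * sqrt k
    \<le> (\<Sum>j<Suc m. cos (2 * pi * (1 / 2 + real j)\<^sup>2 / k))"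
proof -
  define f where "f = (\<lambda>j. cos (2 * pi * (1 / 2 + real j)\<^sup>2 / k))"
  define q where "q = sqrt k"
  \<comment> \<open>The number of odd integers \<open>2 * j + 1\<close> not exceeding
    \<open>q\<close>, that is, of terms with phase at most pi/2.\<close>
  define n where "n = nat \<lfloor>(q + 1) / 2\<rfloor>"
  have q: "5 \<le> q" "q\<^sup>2 = k" using k by (auto simp: q_def real_le_rsqrt)
  have n: "real n \<le> (q + 1) / 2" "(q + 1) / 2 < real n + 1"
    using q(1) of_int_floor_le[of "(q + 1) / 2"] unfolding n_def by (auto simp: of_nat_nat)
  have nm: "n \<le> Suc m"
  proof -
    have "q < 2 * real m + 3"
      unfolding q_def using km by (intro real_less_lsqrt) (auto simp: power2_eq_square algebra_simps intro!: add_pos_nonneg)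
    then have "real n < real m + 2" using n by simp
    then show ?thesis by linarith
  qed
  have head: "1 - 5 / 4 * (2 * real j + 1)\<^sup>2 / k \<le> f j" if "j < n" for j
  proof -
    define v where "v = (2 * real j + 1)\<^sup>2 / k"
    have "(2 * real j + 1)\<^sup>2 = 4 * (1 / 2 + real j)\<^sup>2"
      by (simp add: power2_eq_square field_simps)
    then have x: "2 * pi * (1 / 2 + real j)\<^sup>2 / k = pi / 2 * v"
      unfolding v_def by (simp only:) simp
    have "(2 * real j + 1)\<^sup>2 \<le> q\<^sup>2" using that n(1) by (intro power_mono) auto
    then have v: "0 \<le> v" "v \<le> 1" using q k by (auto simp: v_def)
    then have "v\<^sup>2 \<le> v" unfolding power2_eq_square by (intro mult_left_le)
    then have "(pi / 2 * v)\<^sup>2 \<le> pi\<^sup>2 / 4 * v"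
      by (simp add: power_mult_distrib power_divide)
    also have "\<dots> \<le> 10 / 4 * v"
      using pi_squared_less v by (intro mult_right_mono) auto
    finally have "1 - 5 / 4 * v \<le> cos (pi / 2 * v)"
      using cos_ge_quadratic[of "pi / 2 * v"] by simp
    then show ?thesis unfolding f_def x by (simp add: v_def)
  qed
  \<comment> \<open>The head is at least n (1 - 5/12 (4 n^2 - 1) / k). The chain, read upwards from
    this value, uses (2 n - 1) (2 n + 1) <= q (q + 2) and then the lower bound (q - 1) / 2 for
    n.\<close>
  have "(q - 1) / 2 * (7 / 12 - 5 / 6 / q) \<le> real n * (1 - 5 / 12 * (1 + 2 / q))"
    using n q by (intro mult_mono) (auto simp: field_simps)
  also have "\<dots> \<le> real n * (1 - 5 / 12 * ((4 * (real n)\<^sup>2 - 1) / k))"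
  proof (intro mult_left_mono diff_left_mono)
    have "4 * (real n)\<^sup>2 - 1 = (2 * real n - 1) * (2 * real n + 1)"
      by (simp add: power2_eq_square algebra_simps)
    also have "\<dots> \<le> q * (q + 2)" using n q by (intro mult_mono) auto
    finally have "(4 * (real n)\<^sup>2 - 1) / k \<le> q * (q + 2) / k"
      using k by (intro divide_right_mono) auto
    also have "\<dots> = 1 + 2 / q" using q by (simp add: power2_eq_square field_simps flip: q(2))
    finally show "(4 * (real n)\<^sup>2 - 1) / k \<le> 1 + 2 / q" .
  qed auto
  also have "\<dots> = real n - 5 / 4 * (real n * (4 * (real n)\<^sup>2 - 1) / 3) / k"
    using k by (simp add: field_simps)
  also have "\<dots> = (\<Sum>j<n. 1 - 5 / 4 * (2 * real j + 1)\<^sup>2 / k)"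
    unfolding sum_odd_squares[symmetric]
    by (simp only: sum_subtractf sum_divide_distrib sum_distrib_left) simp
  also have "\<dots> \<le> (\<Sum>j<n. f j)" using head by (intro sum_mono) auto
  also have "(q - 1) / 2 * (7 / 12 - 5 / 6 / q) = 7 / 24 * q - 17 / 24 + 5 / 12 / q"
    using q(1) by (simp add: field_simps)
  finally have head': "7 / 24 * q - 17 / 24 \<le> (\<Sum>j<n. f j)"
    using q(1) by (smt (verit) divide_nonneg_pos)
  have "7 / 24 * q - 17 / 24 - 10 / 29 * q \<le> (\<Sum>j<Suc m. f j)"
  proof (cases "n = Suc m")
    case True
    then show ?thesis using head' q by simp
  next
    case False
    define d where "d = Suc m - n"
    have d: "Suc m = n + d" "0 < d" using False nm by (auto simp: d_def)
    let ?x = "1 / 2 + real n"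
    define y where "y = pi / q"
    have y: "0 < y" using q by (simp add: y_def)
    have y2: "y\<^sup>2 \<le> 0.4"
      using k pi_squared_less q by (simp add: y_def power_divide field_simps)
    have "3.14 / q \<le> y"
      unfolding y_def using q pi_approx by (intro divide_right_mono) auto
    then have "3.14 / q * (1 - 0.4 / 6) \<le> y * (1 - y\<^sup>2 / 6)"
      using y y2 by (intro mult_mono) auto
    also have "\<dots> \<le> sin y" using y by (intro sin_ge_cubic) auto
    finally have "2.9 / q \<le> sin y"
      using q by (simp add: field_simps)
    moreover have "sin y \<le> sin (2 * pi * ?x / k)"
    proof (intro sin_monotone_2pi_le)
      have "2 * pi * ?x / k \<le> 2 * pi * (k / 4) / k"
        using d km k by (intro divide_right_mono mult_left_mono) auto
      then show "2 * pi * ?x / k \<le> pi / 2" using k by simp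
      have "y = 2 * pi * (q / 2) / k"
        using q by (simp add: y_def power2_eq_square field_simps flip: q(2))
      also have "\<dots> \<le> 2 * pi * ?x / k"
        using n k by (intro divide_right_mono mult_left_mono) auto
      finally show "y \<le> 2 * pi * ?x / k" .
      show "- (pi / 2) \<le> y" using y pi_gt_zero by linarith
    qed
    ultimately have s: "2.9 / q \<le> sin (2 * pi * ?x / k)" by simp
    have "(\<Sum>j<d. f (n + j)) = Re (\<Sum>j<d. cis (2 * pi * (?x + real j)\<^sup>2 / k))"
      by (simp add: f_def add.assoc)
    also have "\<bar>\<dots>\<bar> \<le> norm (\<Sum>j<d. cis (2 * pi * (?x + real j)\<^sup>2 / k))"
      by (rule abs_Re_le_cmod)
    also have "\<dots> \<le> 1 / sin (2 * pi * ?x / k)"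
      using k km d by (intro norm_sum_cis_square_le) auto
    also have "\<dots> \<le> 1 / (2.9 / q)"
      using s q less_le_trans[OF _ s, of 0] by (intro divide_left_mono mult_pos_pos) auto
    finally have "\<bar>\<Sum>j<d. f (n + j)\<bar> \<le> 10 / 29 * q" by simp
    then show ?thesis unfolding d sum_lessThan_add using head' by simp
  qed
  then show ?thesis by (simp add: f_def q_def)
qed

text \<open>The margin is (1/2 + 7/24 - 5/19 - 10/29) \<open>sqrt k\<close> - 17/24. Its coefficient
  exceeds 9/50, so \<open>sqrt k\<close> >= 5 makes it positive.\<close>

lemma sum_sin_cos_square_gt:
  assumes "6 \<le> m"
  defines "k \<equiv> 4 * real m + 3"
  shows "- sqrt k / 2 < (\<Sum>j<m. sin (2 * pi * (1 + real j)\<^sup>2 / k))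
    + (\<Sum>j<Suc m. cos (2 * pi * (1 / 2 + real j)\<^sup>2 / k))"
proof -
  have "25 \<le> k" using assms by simp
  then have "5 \<le> sqrt k" by (simp add: real_le_rsqrt)
  moreover have "- (5 / 19) * sqrt k \<le> (\<Sum>j<m. sin (2 * pi * (1 + real j)\<^sup>2 / k))"
    using \<open>25 \<le> k\<close> by (intro sum_sin_square_ge) (auto simp: k_def)
  moreover note sum_cos_square_ge[OF \<open>25 \<le> k\<close> k_def[THEN meta_eq_to_obj_eq]]
  ultimately show ?thesis by linarith
qed

section \<open>Divisor sums of multiplicative functions\<close>

text \<open>A divisor not divisible by \<open>q\<close> divides \<open>m\<close>; the others are
  \<open>q\<close> times a divisor of \<open>q ^ k * m\<close>.\<close>

lemma sum_divisors_mult_prime: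
  fixes f :: "nat \<Rightarrow> int"
  assumes mult: "\<And>a b. f (a * b) = f a * f b"
    and q: "prime q" "\<not> q dvd m" and "0 < m"
  shows "(\<Sum>d | d dvd q ^ Suc k * m. f d)
    = (\<Sum>d | d dvd m. f d) + f q * (\<Sum>d | d dvd q ^ k * m. f d)"
proof -
  have "0 < q" using q(1) prime_gt_0_nat by blast
  have "{d. d dvd q ^ Suc k * m} = {d. d dvd m} \<union> (*) q ` {d. d dvd q ^ k * m}"
  proof (intro equalityI subsetI)
    fix d assume d: "d \<in> {d. d dvd q ^ Suc k * m}"
    show "d \<in> {d. d dvd m} \<union> (*) q ` {d. d dvd q ^ k * m}"
    proof (cases "q dvd d")
      case True
      then obtain e where "d = q * e" by blast
      then show ?thesis using d \<open>0 < q\<close> by (auto simp: mult.assoc)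
    next
      case False
      then have "coprime d (q ^ Suc k)"
        using prime_imp_coprime[OF q(1)] by (simp add: coprime_commute)
      then show ?thesis using d by (simp add: coprime_dvd_mult_right_iff)
    qed
  qed (auto simp: mult.assoc intro: dvd_mult)
  moreover have "{d. d dvd m} \<inter> (*) q ` {d. d dvd q ^ k * m} = {}"
    using q(2) dvd_trans by fastforce
  ultimately have "(\<Sum>d | d dvd q ^ Suc k * m. f d)
      = (\<Sum>d | d dvd m. f d) + (\<Sum>d\<in>(*) q ` {d. d dvd q ^ k * m}. f d)"
    using \<open>0 < m\<close> \<open>0 < q\<close> by (simp add: sum.union_disjoint)
  also have "(\<Sum>d\<in>(*) q ` {d. d dvd q ^ k * m}. f d) = f q * (\<Sum>d | d dvd q ^ k * m. f d)"
    using \<open>0 < q\<close> by (subst sum.reindex) (auto simp: inj_on_def mult sum_distrib_left)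
  finally show ?thesis .
qed

text \<open>One prime \<open>q\<close> is stripped off at a time. With S k the divisor sum of
  \<open>q ^ k * r\<close>, the recurrence is S (k + 1) = S 0 + f q * S k, and a negative value of
  \<open>f q\<close> can only be -1.\<close>

lemma sum_divisors_nonneg:
  fixes f :: "nat \<Rightarrow> int"
  assumes mult: "\<And>a b. f (a * b) = f a * f b" and one: "f 1 = 1"
    and range: "\<And>a. -1 \<le> f a" and "0 < m"
  shows "0 \<le> (\<Sum>d | d dvd m. f d)"
  using \<open>0 < m\<close>
proof (induction m rule: less_induct)
  case (less m)
  show ?case
  proof (cases "m = 1")
    case True
    then show ?thesis using one by simp
  next
    case False
    then obtain q where q: "prime q" "q dvd m" using prime_factor_nat by blast
    obtain r where r: "m = q ^ multiplicity q m * r" "\<not> q dvd r"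
      using multiplicity_decompose'[of m q] q(1) less.prems not_prime_unit[of q] by blast
    have "0 < r" using r(1) less.prems by (auto intro: gr0I)
    have "r \<noteq> m" using r(2) q(2) by blast
    then have "r < m" using r(1) less.prems by (metis dvd_imp_le dvd_triv_right le_neq_implies_less)
    then have 0: "0 \<le> (\<Sum>d | d dvd r. f d)" using less.IH \<open>0 < r\<close> by blast
    \<comment> \<open>For \<open>f q = -1\<close> nonnegativity alone does not carry over to the
      next exponent; the upper bound by the sum for \<open>r\<close> is what makes S 0 - S k
      nonnegative.\<close>
    have "0 \<le> (\<Sum>d | d dvd q ^ k * r. f d) \<and>
        (f q < 0 \<longrightarrow> (\<Sum>d | d dvd q ^ k * r. f d) \<le> (\<Sum>d | d dvd r. f d))" for k
    proof (induction k)
      case 0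
      then show ?case using \<open>0 \<le> (\<Sum>d | d dvd r. f d)\<close> by simp
    next
      case (Suc k)
      note rec = sum_divisors_mult_prime[OF mult q(1) r(2) \<open>0 < r\<close>, of k]
      show ?case
      proof (cases "f q < 0")
        case True
        then have "f q = - 1" using range[of q] by simp
        then show ?thesis using Suc 0 unfolding rec by simp
      next
        case False
        then show ?thesis using Suc 0 unfolding rec by simp
      qed
    qed
    then show ?thesis using r(1) by metis
  qed
qed

lemma card_multiples: "0 < d \<Longrightarrow> card {m \<in> {1..x}. d dvd m} = x div d" for d x :: nat
proof -
  assume d: "0 < d"
  have "bij_betw ((*) d) {1..x div d} {m \<in> {1..x}. d dvd m}"
    using d by (intro bij_betwI[where g="\<lambda>m. m div d"])
      (auto simp: less_eq_div_iff_mult_less_eq mult.commute div_le_mono dvd_imp_le Suc_le_eq)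
  then show ?thesis using bij_betw_same_card by fastforce
qed

lemma sum_divisor_sums:
  fixes f :: "nat \<Rightarrow> int"
  shows "(\<Sum>m=1..x. \<Sum>d | d dvd m. f d) = (\<Sum>d=1..x. f d * int (x div d))"
proof -
  have "(\<Sum>m=1..x. \<Sum>d | d dvd m. f d) = (\<Sum>m=1..x. \<Sum>d | d \<in> {1..x} \<and> d dvd m. f d)"
    by (intro sum.cong refl) (auto simp: Suc_le_eq intro: dvd_imp_le order_trans dest: dvd_pos_nat)
  also have "\<dots> = (\<Sum>d=1..x. \<Sum>m | m \<in> {1..x} \<and> d dvd m. f d)"
    by (rule sum.swap_restrict) auto
  also have "\<dots> = (\<Sum>d=1..x. f d * int (x div d))"
    by (intro sum.cong refl) (use card_multiples in simp)
  finally show ?thesis .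
qed

section \<open>The logarithm on the unit circle\<close>

text \<open>Polar form: 1 - e^(it) = 2 sin (t/2) e^(i (t - pi)/2), whose angle lies in (-pi/2, pi/2)
  and is therefore the principal one.\<close>

lemma Im_Ln_one_minus_cis:
  assumes "0 < t" "t < 2 * pi"
  shows "Im (Ln (1 - cis t)) = (t - pi) / 2"
proof -
  have s: "0 < sin (t / 2)" using assms by (intro sin_gt_zero) auto
  let ?z = "Complex (ln (2 * sin (t / 2))) ((t - pi) / 2)"
  have c: "cos ((t - pi) / 2) = sin (t / 2)" "sin ((t - pi) / 2) = - cos (t / 2)"
    by (simp_all add: diff_divide_distrib cos_diff sin_diff)
  have "cos t = 1 - 2 * (sin (t / 2))\<^sup>2" "sin t = 2 * sin (t / 2) * cos (t / 2)"
    using cos_double_sin[of "t / 2"] sin_double[of "t / 2"] by simp_all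
  then have "exp ?z = 1 - cis t"
    using s by (simp add: complex_eq_iff Re_exp Im_exp c power2_eq_square)
  then have "Ln (1 - cis t) = ?z"
    using assms by (intro Ln_unique) auto
  then show ?thesis by simp
qed

text \<open>Imaginary part of the logarithm series. Division by zero yields 0, so the term at
  \<open>n = 0\<close> vanishes and the series may start there.\<close>

lemma sums_sin_Ln:
  assumes "0 < r" "r < 1"
  shows "(\<lambda>n. r ^ n * sin (real n * t) / real n) sums - Im (Ln (1 - of_real r * cis t))"
proof -
  have "(\<lambda>n. - ((of_real r * cis t) ^ n) / of_nat n) sums Ln (1 + - (of_real r * cis t))"
    using Ln_series'[of "- (of_real r * cis t)"] assms by (simp add: norm_mult)
  then have "(\<lambda>n. Im (- ((of_real r * cis t) ^ n) / of_nat n)) sums Im (Ln (1 + - (of_real r * cis t)))"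
    by (rule sums_Im)
  moreover have "Im (- ((of_real r * cis t) ^ n) / of_nat n) = - (r ^ n * sin (real n * t) / real n)" for n
    by (simp add: power_mult_distrib Complex.DeMoivre Im_divide_of_nat flip: of_real_power)
  ultimately have "(\<lambda>n. - (r ^ n * sin (real n * t) / real n)) sums Im (Ln (1 - of_real r * cis t))"
    by (simp only: add_uminus_conv_diff)
  from sums_minus[OF this] show ?thesis by simp
qed

text \<open>The limit point 1 - e^(it) has positive real part, so \<open>Ln\<close> is continuous
  there.\<close>

lemma tendsto_Im_Ln_one_minus_cis:
  assumes "0 < t" "t < 2 * pi"
  shows "((\<lambda>r. - Im (Ln (1 - of_real r * cis t))) \<longlongrightarrow> (pi - t) / 2) (at_left 1)"
proof -
  have "cos t \<noteq> 1"
  proof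
    assume "cos t = 1"
    then obtain k :: int where k: "t = of_int k * 2 * pi" by (auto simp: cos_one_2pi_int)
    then have "0 < k" "k < 1" using assms by (auto simp: zero_less_mult_iff)
    then show False by simp
  qed
  then have "0 < Re (1 - cis t)" using cos_le_one[of t] by (simp add: order_less_le)
  then have "1 - cis t \<notin> \<real>\<^sub>\<le>\<^sub>0" by (auto simp: complex_nonpos_Reals_iff)
  then have "((\<lambda>r. - Im (Ln (1 - of_real r * cis t))) \<longlongrightarrow> - Im (Ln (1 - of_real 1 * cis t))) (at_left 1)"
    by (intro tendsto_intros) simp
  then show ?thesis by (simp add: Im_Ln_one_minus_cis[OF assms] minus_divide_left)
qed

section \<open>The sign of the Gauss sum\<close>

locale prime_3_mod_4 =
  fixes p :: int
  assumes prime_p: "prime p" and p_cong: "[p = 3] (mod 4)"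
begin

section \<open>The Legendre symbol as an odd, completely multiplicative function\<close>

abbreviation \<psi> :: "int \<Rightarrow> int" where "\<psi> a \<equiv> Legendre a p"

lemma p_mod_4: "p mod 4 = 3"
  using p_cong by (simp add: Cong.cong_def)

lemma p_ge_3: "3 \<le> p"
  using p_mod_4 prime_gt_0_int[OF prime_p] by presburger

lemma Legendre_cases: "\<psi> a = -1 \<or> \<psi> a = 0 \<or> \<psi> a = 1"
  by (simp add: Legendre_def)

lemma abs_Legendre_le_1: "\<bar>\<psi> a\<bar> \<le> 1"
  using Legendre_cases[of a] by auto

lemma Legendre_eq_0_iff: "\<psi> a = 0 \<longleftrightarrow> p dvd a"
  by (auto simp: Legendre_def cong_0_iff)

lemma Legendre_square: "\<not> p dvd a \<Longrightarrow> \<psi> a * \<psi> a = 1"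
  using Legendre_cases[of a] Legendre_eq_0_iff[of a] by auto

lemma Legendre_cong: "[a = b] (mod p) \<Longrightarrow> \<psi> a = \<psi> b"
  by (metis (no_types, opaque_lifting) Legendre_def QuadRes_def cong_sym_eq cong_trans)

lemma Legendre_mod: "\<psi> (a mod p) = \<psi> a"
  by (rule Legendre_cong) simp

lemma Legendre_euler: "[\<psi> a = a ^ nat ((p - 1) div 2)] (mod p)"
proof -
  have "prime (nat p)" "int (nat p) = p" "2 < nat p"
    using prime_p p_ge_3 by (auto simp: prime_nat_iff_prime)
  then show ?thesis using euler_criterion[of "nat p" a]
    by (simp add: nat_div_distrib nat_diff_distrib)
qed

text \<open>Two integers of absolute value at most 1 differ by at most 2 < p. This turns the
  congruences of Euler's criterion into equalities.\<close>

lemma Legendre_eqI: "\<psi> a = x" if "[\<psi> a = x] (mod p)" "\<bar>x\<bar> \<le> 1"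
proof (rule ccontr)
  assume "\<psi> a \<noteq> x"
  moreover have "p dvd \<psi> a - x" using that(1) by (simp add: cong_iff_dvd_diff)
  ultimately have "\<bar>p\<bar> \<le> \<bar>\<psi> a - x\<bar>" by (intro dvd_imp_le_int) auto
  then show False using that(2) abs_Legendre_le_1[of a] p_ge_3 by linarith
qed

lemma Legendre_mult: "\<psi> (a * b) = \<psi> a * \<psi> b"
proof (rule Legendre_eqI)
  let ?e = "nat ((p - 1) div 2)"
  have "[\<psi> (a * b) = a ^ ?e * b ^ ?e] (mod p)"
    using Legendre_euler[of "a * b"] by (simp add: power_mult_distrib)
  also have "[a ^ ?e * b ^ ?e = \<psi> a * \<psi> b] (mod p)"
    by (intro cong_mult cong_sym[OF Legendre_euler])
  finally show "[\<psi> (a * b) = \<psi> a * \<psi> b] (mod p)" .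
  show "\<bar>\<psi> a * \<psi> b\<bar> \<le> 1" using Legendre_cases[of a] Legendre_cases[of b] by auto
qed

lemma Legendre_1: "\<psi> 1 = 1"
  by (rule Legendre_eqI[OF cong_trans[OF Legendre_euler]]) auto

text \<open>The exponent (p - 1) / 2 in Euler's criterion is odd because p is 3 modulo 4.\<close>

lemma Legendre_minus: "\<psi> (- a) = - \<psi> a"
proof -
  have "odd (nat ((p - 1) div 2))"
    using p_mod_4 p_ge_3 by (simp add: even_nat_iff) presburger
  then have "\<psi> (- 1) = - 1"
    by (intro Legendre_eqI[OF cong_trans[OF Legendre_euler]]) auto
  then show ?thesis using Legendre_mult[of "- 1" a] by simp
qed

lemma Legendre_p_minus: "\<psi> (p - a) = - \<psi> a"
  using Legendre_cong[of "p - a" "- a"] Legendre_minus by (simp add: cong_iff_dvd_diff)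

lemma sum_reflect: "(\<Sum>a\<in>{1..<p}. f (p - a)) = (\<Sum>a\<in>{1..<p}. f a)"
  by (rule sum.reindex_bij_witness[of _ "\<lambda>a. p - a" "\<lambda>a. p - a"]) auto

lemma sum_mult_mod:
  assumes "\<not> p dvd n"
  shows "(\<Sum>a\<in>{1..<p}. f (n * a mod p)) = (\<Sum>a\<in>{1..<p}. f a)"
proof -
  have "coprime n p" using prime_imp_coprime[OF prime_p assms] by (simp add: coprime_commute)
  then show ?thesis by (intro sum.reindex_bij_betw bij_betw_int_remainders_mult)
qed

lemma sum_Legendre: "(\<Sum>a\<in>{1..<p}. \<psi> a) = 0"
  using sum_reflect[of \<psi>] by (simp add: Legendre_p_minus sum_negf)

section \<open>Separability and square of the Gauss sum\<close>

definition angle :: "int \<Rightarrow> real" where "angle a = 2 * pi * of_int a / of_int p"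

lemma angle_simps: "angle (a + b) = angle a + angle b" "angle (a - b) = angle a - angle b"
    "angle (- a) = - angle a" "angle p = 2 * pi" "angle 0 = 0"
  using p_ge_3 by (auto simp: angle_def ring_distribs add_divide_distrib diff_divide_distrib)

lemma angle_multiple: "angle (p * k) = 2 * pi * of_int k"
  using p_ge_3 by (simp add: angle_def)

lemma sin_angle_mod: "sin (angle (a mod p)) = sin (angle a)"
proof -
  have "angle a = angle (a mod p) + 2 * pi * of_int (a div p)"
    using angle_simps(1)[of "a mod p" "p * (a div p)"] by (simp add: angle_multiple)
  then show ?thesis by (simp add: sin_add)
qed

text \<open>Imaginary part of the Gauss sum at frequency \<open>n\<close>. The real part vanishes
  since \<open>\<psi>\<close> is odd and the cosine is even.\<close>

definition gauss_sin :: "int \<Rightarrow> real" where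
  "gauss_sin n = (\<Sum>a\<in>{1..<p}. \<psi> a * sin (angle (a * n)))"

text \<open>For \<open>n\<close> prime to \<open>p\<close>, multiplication by \<open>n\<close>
  permutes the nonzero residues; for \<open>n\<close> divisible by \<open>p\<close>, every sine is 0
  and so is \<open>\<psi> n\<close>.\<close>

lemma gauss_sin_separable: "gauss_sin n = \<psi> n * gauss_sin 1"
proof (cases "p dvd n")
  case True
  then obtain k where "n = p * k" by blast
  then have "angle (a * n) = 2 * pi * of_int (a * k)" for a
    using angle_multiple[of "a * k"] by (simp add: mult_ac)
  then have "sin (angle (a * n)) = 0" for a by (simp only: sin_int_2pin)
  then show ?thesis using True by (simp add: gauss_sin_def Legendre_eq_0_iff[THEN iffD2])
next
  case False
  have "gauss_sin 1 = (\<Sum>a\<in>{1..<p}. \<psi> (n * a mod p) * sin (angle (n * a mod p)))"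
    unfolding gauss_sin_def mult_1_right by (rule sum_mult_mod[OF False, symmetric])
  also have "\<dots> = \<psi> n * gauss_sin n"
    by (simp add: gauss_sin_def sin_angle_mod Legendre_mod Legendre_mult sum_distrib_left mult_ac)
  finally have "\<psi> n * gauss_sin 1 = (\<psi> n * \<psi> n) * gauss_sin n" by simp
  then show ?thesis using Legendre_square[OF False] by simp
qed

text \<open>Real part of a geometric sum of p-th roots of unity; the \<open>- 1\<close> removes the
  residue 0.\<close>

lemma sum_cos_angle: "(\<Sum>n\<in>{1..<p}. cos (angle (m * n))) = (if p dvd m then p else 0) - 1"
proof (cases "p dvd m")
  case True
  then obtain k where "m = p * k" by blast
  then have "angle (m * n) = 2 * pi * of_int (k * n)" for n
    using angle_multiple[of "k * n"] by (simp add: mult.assoc)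
  then have "cos (angle (m * n)) = 1" for n by (simp only: cos_int_2pin)
  then show ?thesis using True p_ge_3 by simp
next
  case False
  define w where "w = cis (angle m)"
  have "w \<noteq> 1"
  proof
    assume "w = 1"
    then have "cos (angle m) = 1" by (simp add: w_def complex_eq_iff)
    then obtain k :: int where "angle m = of_int k * 2 * pi" by (auto simp: cos_one_2pi_int)
    then have "of_int m = (of_int (p * k) :: real)" using p_ge_3 by (simp add: angle_def field_simps)
    then show False using False by (simp only: of_int_eq_iff) auto
  qed
  have pow: "w ^ j = cis (angle (m * int j))" for j
    by (simp add: w_def Complex.DeMoivre angle_def mult_ac)
  have "w ^ nat p = 1" using p_ge_3 angle_multiple[of m] by (simp add: pow mult.commute[of m])
  then have "(\<Sum>j<nat p. w ^ j) = 0" using \<open>w \<noteq> 1\<close> by (simp add: geometric_sum)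
  then have "0 = (\<Sum>j<nat p. cos (angle (m * int j)))" by (simp add: pow complex_eq_iff)
  also have "\<dots> = (\<Sum>n\<in>{0..<p}. cos (angle (m * n)))"
    by (rule sum.reindex_bij_witness[of _ nat int]) auto
  also have "{0..<p} = insert 0 {1..<p}" using p_ge_3 by auto
  finally show ?thesis using False by (simp add: angle_simps)
qed

text \<open>Parseval: the sum of \<open>(gauss_sin n)\<^sup>2\<close> over nonzero residues is
  \<open>(p - 1) * (gauss_sin 1)\<^sup>2\<close> by separability. Expanded and summed over
  \<open>n\<close> first, each \<open>a\<close> contributes p/2 from \<open>b = a\<close> and, since
  \<open>\<psi>\<close> is odd, p/2 from \<open>b = p - a\<close>.\<close>

lemma gauss_sin_squared: "(gauss_sin 1)\<^sup>2 = p"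
proof -
  have "(p - 1) * (gauss_sin 1)\<^sup>2 = (\<Sum>n\<in>{1..<p}. (gauss_sin n)\<^sup>2)"
  proof -
    have "(gauss_sin n)\<^sup>2 = (gauss_sin 1)\<^sup>2" if "n \<in> {1..<p}" for n
    proof -
      have "\<psi> n * \<psi> n = 1" using that by (intro Legendre_square) (auto dest: zdvd_imp_le)
      then have "real_of_int (\<psi> n) * \<psi> n = 1" by (simp flip: of_int_mult)
      then show ?thesis
        by (subst gauss_sin_separable) (simp add: power_mult_distrib power2_eq_square)
    qed
    then have "(\<Sum>n\<in>{1..<p}. (gauss_sin n)\<^sup>2) = (\<Sum>n\<in>{1..<p}. (gauss_sin 1)\<^sup>2)"
      by (intro sum.cong refl)
    also have "\<dots> = (p - 1) * (gauss_sin 1)\<^sup>2" using p_ge_3 by simp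
    finally show ?thesis by simp
  qed
  also have "\<dots> = (\<Sum>n\<in>{1..<p}. \<Sum>a\<in>{1..<p}. \<Sum>b\<in>{1..<p}.
      \<psi> a * sin (angle (a * n)) * (\<psi> b * sin (angle (b * n))))"
    by (simp add: power2_eq_square gauss_sin_def sum_product)
  also have "\<dots> = (\<Sum>a\<in>{1..<p}. \<Sum>b\<in>{1..<p}. \<psi> a * \<psi> b *
      (\<Sum>n\<in>{1..<p}. sin (angle (a * n)) * sin (angle (b * n))))"
    by (subst sum.swap, rule sum.cong[OF refl], subst sum.swap) (simp add: sum_distrib_left mult_ac)
  also have "\<dots> = (\<Sum>a\<in>{1..<p}. real_of_int p)"
  proof (rule sum.cong[OF refl])
    fix a assume a: "a \<in> {1..<p}"
    \<comment> \<open>As \<open>p\<close> is odd, the cases \<open>b = a\<close> and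
      \<open>b = p - a\<close> exclude each other.\<close>
    have "2 * a \<noteq> p" using p_mod_4 by presburger
    have inner: "(\<Sum>n\<in>{1..<p}. sin (angle (a * n)) * sin (angle (b * n)))
        = (if b = a then p / 2 else 0) - (if b = p - a then p / 2 else 0)"
      if b: "b \<in> {1..<p}" for b
    proof -
      \<comment> \<open>In this difference of cosine sums the two terms \<open>- 1\<close> of
        \<open>sum_cos_angle\<close> cancel.\<close>
      have S: "(\<Sum>n\<in>{1..<p}. sin (angle (a * n)) * sin (angle (b * n)))
          = ((\<Sum>n\<in>{1..<p}. cos (angle ((a - b) * n))) - (\<Sum>n\<in>{1..<p}. cos (angle ((a + b) * n)))) / 2"
        by (simp add: sin_times_sin ring_distribs angle_simps flip: sum_subtractf sum_divide_distrib)
      have minus: "p dvd a - b \<longleftrightarrow> b = a"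
      proof
        assume "p dvd a - b"
        then show "b = a" using a b zdvd_imp_le[of p "a - b"] zdvd_imp_le[of p "b - a"]
          by (cases a b rule: linorder_cases) (auto simp: dvd_diff_commute)
      qed simp
      have plus: "p dvd a + b \<longleftrightarrow> b = p - a"
      proof
        assume "p dvd a + b"
        then have "p dvd a + b - p" by simp
        then show "b = p - a"
          using a b zdvd_imp_le[of p "a + b - p"] zdvd_imp_le[of p "p - (a + b)"]
          by (cases "a + b" p rule: linorder_cases) (auto simp: dvd_diff_commute)
      qed simp
      show ?thesis unfolding S sum_cos_angle minus plus by simp
    qed
    have "(\<Sum>b\<in>{1..<p}. \<psi> a * \<psi> b * (\<Sum>n\<in>{1..<p}. sin (angle (a * n)) * sin (angle (b * n))))
        = (\<Sum>b\<in>{1..<p}. (if b = a then \<psi> a * \<psi> b * p / 2 else 0)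
            - (if b = p - a then \<psi> a * \<psi> b * p / 2 else 0))"
      using \<open>2 * a \<noteq> p\<close> by (intro sum.cong refl) (simp add: inner)
    also have "\<dots> = \<psi> a * \<psi> a * p / 2 - \<psi> a * \<psi> (p - a) * p / 2"
      using a by (simp add: sum_subtractf)
    also have "\<dots> = (\<psi> a * \<psi> a) * p" by (simp add: Legendre_p_minus)
    also have "\<psi> a * \<psi> a = 1"
      using a by (intro Legendre_square) (auto dest: zdvd_imp_le)
    finally show "(\<Sum>b\<in>{1..<p}. \<psi> a * \<psi> b * (\<Sum>n\<in>{1..<p}. sin (angle (a * n)) * sin (angle (b * n))))
      = real_of_int p" by simp
  qed
  finally show ?thesis using p_ge_3 by simp
qed

section \<open>The Gauss sum as a sum over squares, and its sign\<close>

lemma card_square_roots: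
  assumes a: "a \<in> {1..<p}"
  shows "int (card {r \<in> {1..<p}. r\<^sup>2 mod p = a}) = 1 + \<psi> a"
proof (cases "QuadRes p a")
  case True
  have na: "\<not> p dvd a" using a by (auto dest: zdvd_imp_le)
  from True obtain y where y: "[y\<^sup>2 = a] (mod p)" by (auto simp: QuadRes_def)
  define x where "x = y mod p"
  have x: "x\<^sup>2 mod p = a"
    using y a by (simp add: x_def power_mod Cong.cong_def)
  have "x \<noteq> 0" using x a by auto
  moreover have "0 \<le> x" "x < p" using p_ge_3 by (simp_all add: x_def)
  ultimately have x': "x \<in> {1..<p}" by simp
  have "{r \<in> {1..<p}. r\<^sup>2 mod p = a} = {x, p - x}"
  proof (intro equalityI subsetI)
    fix r assume r: "r \<in> {r \<in> {1..<p}. r\<^sup>2 mod p = a}"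
    then have "r\<^sup>2 mod p = x\<^sup>2 mod p" using x by simp
    then have "p dvd r\<^sup>2 - x\<^sup>2" by (simp only: mod_eq_dvd_iff)
    then have "p dvd (r - x) * (r + x)" by (simp add: power2_eq_square algebra_simps)
    then consider "p dvd r - x" | "p dvd r + x" using prime_dvd_mult_iff[OF prime_p] by blast
    then show "r \<in> {x, p - x}"
    proof cases
      case 1
      then show ?thesis using r x' zdvd_imp_le[of p "r - x"] zdvd_imp_le[of p "x - r"]
        by (cases r x rule: linorder_cases) (auto simp: dvd_diff_commute)
    next
      case 2
      then have "p dvd r + x - p" by simp
      then show ?thesis using r x' zdvd_imp_le[of p "r + x - p"] zdvd_imp_le[of p "p - (r + x)"]
        by (cases "r + x" p rule: linorder_cases) (auto simp: dvd_diff_commute)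
    qed
  next
    fix r assume "r \<in> {x, p - x}"
    moreover have "(p - x)\<^sup>2 mod p = x\<^sup>2 mod p"
      by (simp add: mod_eq_dvd_iff power2_eq_square algebra_simps)
    ultimately show "r \<in> {r \<in> {1..<p}. r\<^sup>2 mod p = a}" using x x' by auto
  qed
  moreover have "x \<noteq> p - x" using p_mod_4 by presburger
  moreover have "\<psi> a = 1" using True na by (simp add: Legendre_def cong_0_iff)
  ultimately show ?thesis by simp
next
  case False
  have "\<not> p dvd a" using a by (auto dest: zdvd_imp_le)
  then have "\<psi> a = - 1" using False by (simp add: Legendre_def cong_0_iff)
  moreover have "r\<^sup>2 mod p \<noteq> a" for r
    using False a by (auto simp: QuadRes_def Cong.cong_def)
  ultimately show ?thesis by simp
qed

text \<open>Grouping the \<open>r\<close> by their squares gives each residue \<open>a\<close> the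
  weight \<open>1 + \<psi> a\<close>; the part with weight 1 vanishes under the reflection of
  \<open>a\<close> to \<open>p - a\<close>.\<close>

lemma gauss_sin_eq_sum_squares: "gauss_sin 1 = (\<Sum>r\<in>{1..<p}. sin (angle (r\<^sup>2)))"
proof -
  have sub: "(\<lambda>r. r\<^sup>2 mod p) ` {1..<p} \<subseteq> {1..<p}"
  proof (clarify)
    fix r assume r: "r \<in> {1..<p}"
    then have "\<not> p dvd r" by (auto dest: zdvd_imp_le)
    then have "r\<^sup>2 mod p \<noteq> 0"
      using prime_dvd_power_iff[OF prime_p, of 2 r] by (simp add: dvd_eq_mod_eq_0)
    moreover have "0 \<le> r\<^sup>2 mod p" "r\<^sup>2 mod p < p" using p_ge_3 by auto
    ultimately show "r\<^sup>2 mod p \<in> {1..<p}" by simp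
  qed
  have "(\<Sum>r\<in>{1..<p}. sin (angle (r\<^sup>2)))
      = (\<Sum>a\<in>{1..<p}. \<Sum>r | r \<in> {1..<p} \<and> r\<^sup>2 mod p = a. sin (angle (r\<^sup>2)))"
    using sub by (intro sum.group[symmetric]) auto
  also have "\<dots> = (\<Sum>a\<in>{1..<p}. (1 + \<psi> a) * sin (angle a))"
  proof (rule sum.cong[OF refl])
    fix a assume a: "a \<in> {1..<p}"
    have "(\<Sum>r | r \<in> {1..<p} \<and> r\<^sup>2 mod p = a. sin (angle (r\<^sup>2)))
        = (\<Sum>r | r \<in> {1..<p} \<and> r\<^sup>2 mod p = a. sin (angle a))"
      by (intro sum.cong refl) (use sin_angle_mod in force)
    also have "\<dots> = real_of_int (int (card {r \<in> {1..<p}. r\<^sup>2 mod p = a})) * sin (angle a)"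
      by simp
    finally show "(\<Sum>r | r \<in> {1..<p} \<and> r\<^sup>2 mod p = a. sin (angle (r\<^sup>2))) = (1 + \<psi> a) * sin (angle a)"
      unfolding card_square_roots[OF a] by simp
  qed
  also have "\<dots> = (\<Sum>a\<in>{1..<p}. sin (angle a)) + gauss_sin 1"
    by (simp add: gauss_sin_def ring_distribs sum.distrib)
  also have "(\<Sum>a\<in>{1..<p}. sin (angle a)) = 0"
    using sum_reflect[of "\<lambda>a. sin (angle a)"] by (simp add: angle_simps sum_negf)
  finally show ?thesis by simp
qed

text \<open>Folding \<open>r\<close> with \<open>p - r\<close> leaves twice the sum over r < p/2.
  The range r <= m gives the sine sum; counting the rest backwards from p/2 gives the cosine sum.
  The resulting bound excludes the value \<open>- sqrt p\<close>.\<close>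

lemma gauss_sin_pos:
  assumes "25 \<le> p"
  shows "0 < gauss_sin 1"
proof -
  define m where "m = nat (p div 4)"
  have p: "p = 4 * int m + 3"
    using p_mod_4 p_ge_3 mult_div_mod_eq[of 4 p] by (simp add: m_def)
  define h where "h = (\<lambda>r. sin (angle (r\<^sup>2)))"
  have refl: "h (p - r) = h r" for r
  proof -
    have "(p - r)\<^sup>2 mod p = r\<^sup>2 mod p"
      by (simp add: mod_eq_dvd_iff power2_eq_square algebra_simps)
    then show ?thesis unfolding h_def by (metis sin_angle_mod)
  qed
  have "gauss_sin 1 = (\<Sum>r\<in>{1..2 * int m + 1} \<union> {2 * int m + 2..<p}. h r)"
    unfolding gauss_sin_eq_sum_squares h_def by (rule sum.cong) (auto simp: p)
  also have "\<dots> = (\<Sum>r\<in>{1..2 * int m + 1}. h r) + (\<Sum>r\<in>{2 * int m + 2..<p}. h r)"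
    by (rule sum.union_disjoint) auto
  also have "(\<Sum>r\<in>{2 * int m + 2..<p}. h r) = (\<Sum>r\<in>{1..2 * int m + 1}. h r)"
    by (rule sum.reindex_bij_witness[of _ "\<lambda>r. p - r" "\<lambda>r. p - r"]) (auto simp: p refl[unfolded p])
  also have "{1..2 * int m + 1} = {1..int m} \<union> {int m + 1..2 * int m + 1}" by auto
  also have "(\<Sum>r\<in>{1..int m} \<union> {int m + 1..2 * int m + 1}. h r)
      = (\<Sum>r\<in>{1..int m}. h r) + (\<Sum>r\<in>{int m + 1..2 * int m + 1}. h r)"
    by (rule sum.union_disjoint) auto
  also have "(\<Sum>r\<in>{1..int m}. h r) = (\<Sum>j<m. sin (2 * pi * (1 + real j)\<^sup>2 / p))"
    by (rule sum.reindex_bij_witness[of _ "\<lambda>j. 1 + int j" "\<lambda>r. nat (r - 1)"])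
      (auto simp: h_def angle_def)
  also have "(\<Sum>r\<in>{int m + 1..2 * int m + 1}. h r)
      = (\<Sum>j<Suc m. cos (2 * pi * (1 / 2 + real j)\<^sup>2 / p))"
  proof (rule sum.reindex_bij_witness[of _ "\<lambda>j. 2 * int m + 1 - int j" "\<lambda>r. nat (2 * int m + 1 - r)"])
    fix r assume r: "r \<in> {int m + 1..2 * int m + 1}"
    define j where "j = nat (2 * int m + 1 - r)"
    have rj: "r = 2 * int m + 1 - int j" using r by (simp add: j_def)
    let ?x = "2 * pi * (1 / 2 + real j)\<^sup>2 / p"
    \<comment> \<open>Here r = p/2 - (1/2 + j). Expanding the square, the terms free of
      \<open>?x\<close> add up to pi/2 modulo 2 pi because p = 4 m + 3.\<close>
    have "angle (r\<^sup>2) = (pi / 2 + ?x) + 2 * pi * of_int (int m - int j)"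
      using p_ge_3 unfolding angle_def
      by (simp add: rj p field_simps) (simp add: power2_eq_square algebra_simps)
    then have "h r = sin (pi / 2 + ?x)"
      unfolding h_def by (simp only: sin_add sin_int_2pin cos_int_2pin) simp
    then show "cos (2 * pi * (1 / 2 + real (nat (2 * int m + 1 - r)))\<^sup>2 / p) = h r"
      by (simp add: sin_add j_def)
  qed auto
  finally have "gauss_sin 1 / 2 = (\<Sum>j<m. sin (2 * pi * (1 + real j)\<^sup>2 / p))
      + (\<Sum>j<Suc m. cos (2 * pi * (1 / 2 + real j)\<^sup>2 / p))" by simp
  moreover have "- sqrt p / 2 < \<dots>"
    using sum_sin_cos_square_gt[of m] assms p by simp
  ultimately have "- sqrt p < gauss_sin 1" by simp
  moreover have "\<bar>gauss_sin 1\<bar> = sqrt p"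
    using gauss_sin_squared by (metis real_sqrt_abs)
  ultimately show ?thesis using p_ge_3 by (smt (verit) of_int_pos real_sqrt_gt_zero)
qed

section \<open>Positivity of the half sum\<close>

lemma sum_Legendre_lessThan_period: "(\<Sum>n<nat p. \<psi> (int n)) = 0"
proof -
  have "(\<Sum>n<nat p. \<psi> (int n)) = (\<Sum>a\<in>{0..<p}. \<psi> a)"
    by (rule sum.reindex_bij_witness[of _ nat int]) auto
  also have "{0..<p} = insert 0 {1..<p}" using p_ge_3 by auto
  finally show ?thesis using sum_Legendre by (simp add: Legendre_eq_0_iff[THEN iffD2])
qed

lemma abs_sum_Legendre_le: "\<bar>\<Sum>n<N. \<psi> (int n)\<bar> \<le> p"
proof (induction N rule: less_induct)
  case (less N)
  show ?case
  proof (cases "N < nat p")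
    case True
    have "\<bar>\<Sum>n<N. \<psi> (int n)\<bar> \<le> (\<Sum>n<N. 1)"
      by (rule order_trans[OF sum_abs]) (intro sum_mono abs_Legendre_le_1)
    then show ?thesis using True by simp
  next
    case False
    define d where "d = N - nat p"
    have N: "N = nat p + d" using False by (simp add: d_def)
    have "\<psi> (int (nat p + n)) = \<psi> (int n)" for n
      using p_ge_3 by (intro Legendre_cong) (simp add: Cong.cong_def)
    then have "(\<Sum>n<N. \<psi> (int n)) = (\<Sum>n<d. \<psi> (int n))"
      unfolding N sum_lessThan_add sum_Legendre_lessThan_period by simp
    then show ?thesis using less[of d] N p_ge_3 by simp
  qed
qed

text \<open>With x = D^2, the sum over d <= x of \<open>\<psi> d\<close> times the integer part of
  x/d is nonnegative, being a sum of divisor sums. For d <= D, replacing the integer part by x/d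
  costs at most 1 per term. The rest is at most 2 p D by summation by parts. Division by D^2 gives
  the bound.\<close>

lemma sum_Legendre_over_ge:
  assumes "0 < D"
  shows "- (2 * p + 1) / D \<le> (\<Sum>d=1..D. \<psi> (int d) / real d)"
proof -
  define x where "x = D ^ 2"
  define g where "g = (\<lambda>d. real_of_int (\<psi> (int d)) * real (x div d))"
  define N where "N = x - D"
  have "D * 1 \<le> D * D" using assms by (intro mult_left_mono) auto
  then have "D \<le> x" by (simp add: x_def power2_eq_square)
  then have N: "Suc x = Suc D + N" by (simp add: N_def)
  have shift: "(\<Sum>d=1..y. h d) = (\<Sum>d<Suc y. h d)" if "h 0 = 0" for y and h :: "nat \<Rightarrow> real"
    using that by (induction y) simp_all
  have g0: "g 0 = 0" by (simp add: g_def)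
  have "0 \<le> (\<Sum>m=1..x. \<Sum>d | d dvd m. \<psi> (int d))"
    using abs_Legendre_le_1
    by (intro sum_nonneg sum_divisors_nonneg[where f="\<lambda>d. \<psi> (int d)"])
      (auto simp: Legendre_mult Legendre_1 abs_le_iff minus_le_iff)
  then have "0 \<le> real_of_int (\<Sum>d=1..x. \<psi> (int d) * int (x div d))"
    unfolding sum_divisor_sums by (simp only: of_int_0_le_iff)
  then have "0 \<le> (\<Sum>d=1..x. g d)"
    by (simp only: g_def of_int_sum of_int_mult of_int_of_nat_eq)
  also have "\<dots> = (\<Sum>d=1..D. g d) + (\<Sum>j<N. g (Suc D + j))"
    unfolding shift[of g, OF g0] N sum_lessThan_add by simp
  also have "(\<Sum>j<N. g (Suc D + j)) \<le> 2 * p * D"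
  proof (cases "N = 0")
    case True
    then show ?thesis using p_ge_3 by simp
  next
    case False
    define c where "c = (\<lambda>j. real (x div (Suc D + j)))"
    \<comment> \<open>Partial sums of \<open>\<psi>\<close>, scaled by \<open>p\<close> to have
      absolute value at most 1; successive differences recover
      \<open>\<psi> (Suc D + j) / p\<close>.\<close>
    define E where "E = (\<lambda>j. real_of_int (\<Sum>n<Suc D + j. \<psi> (int n)) / p)"
    have "norm (\<Sum>j<N. c j *\<^sub>R (E (Suc j) - E j)) \<le> 2 * c 0"
    proof (rule norm_sum_decreasing_scaleR_diff_le)
      show "norm (E j) \<le> 1" for j
        unfolding E_def using abs_sum_Legendre_le[of "Suc D + j"] p_ge_3
        by (simp del: sum.lessThan_Suc of_int_sum add: divide_le_eq flip: of_int_abs)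
    qed (use False in \<open>auto simp: c_def intro: div_le_mono2\<close>)
    also have "(\<Sum>j<N. c j *\<^sub>R (E (Suc j) - E j)) = (\<Sum>j<N. g (Suc D + j)) / p"
      by (simp add: c_def E_def g_def diff_divide_distrib[symmetric] sum_divide_distrib mult_ac add_ac)
    finally have "(\<Sum>j<N. g (Suc D + j)) / p \<le> 2 * c 0"
      by (simp only: real_norm_def abs_le_iff)
    moreover have "x div Suc D \<le> D"
      unfolding x_def using div_le_mono2[of D "Suc D" "D ^ 2"] assms by (simp add: power2_eq_square)
    then have "c 0 \<le> D" by (simp add: c_def)
    ultimately have "(\<Sum>j<N. g (Suc D + j)) / p \<le> 2 * D" by linarith
    then show ?thesis using p_ge_3 by (simp add: divide_le_eq mult_ac)
  qed
  also have "(\<Sum>d=1..D. g d) \<le> (\<Sum>d=1..D. x * (\<psi> (int d) / real d) + 1)"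
  proof (rule sum_mono)
    fix d assume d: "d \<in> {1..D}"
    have 1: "real (x div d) \<le> x / d" by (rule of_nat_div_le_of_nat)
    have "x < d + d * (x div d)" using d by (intro dividend_less_times_div) auto
    then have "real x < real (d + d * (x div d))" by (simp only: of_nat_less_iff)
    then have 2: "x / d < real (x div d) + 1" using d by (simp add: divide_less_eq algebra_simps)
    show "g d \<le> x * (\<psi> (int d) / real d) + 1"
      using Legendre_cases[of "int d"] 1 2 unfolding g_def by auto
  qed
  also have "\<dots> = x * (\<Sum>d=1..D. \<psi> (int d) / real d) + D"
    by (simp add: sum.distrib sum_distrib_left)
  finally have "- (2 * p + 1) * real D \<le> x * (\<Sum>d=1..D. \<psi> (int d) / real d)"
    by (simp add: algebra_simps)
  then show ?thesis using assms by (simp add: x_def power2_eq_square divide_le_eq mult_ac)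
qed

text \<open>Abel summation writes the series through the partial sums \<open>U n\<close> with
  weights r^n - r^(n+1) >= 0. Inserting \<open>U n\<close> >= -C/n leaves -C (1 - r) times the
  logarithm series, a lower bound that tends to 0 as \<open>r\<close> tends to 1.\<close>

lemma suminf_Legendre_ge:
  fixes r :: real
  assumes r: "0 < r" "r < 1" and f: "(\<lambda>n. \<psi> (int n) * r ^ n / real n) sums s"
  shows "(2 * p + 1) * ((1 - r) * ln (1 - r)) \<le> s"
proof -
  define C where "C = real_of_int (2 * p + 1)"
  define U where "U = (\<lambda>n. \<Sum>d=1..n. \<psi> (int d) / real d)"
  have C: "0 < C" using p_ge_3 by (simp add: C_def)
  \<comment> \<open>At \<open>n = 0\<close> both sides are 0, the left one by division by
    zero.\<close>
  have U: "- C / n \<le> U n" for n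
    using sum_Legendre_over_ge[of n] by (cases "n = 0") (auto simp: U_def C_def)
  have log: "(\<lambda>n. r ^ n / real n) sums - ln (1 - r)"
    using sums_minus[OF ln_series'[of "- r"]] r by simp
  have "(\<Sum>d<Suc N. \<psi> (int d) * r ^ d / real d)
      = (\<Sum>n<N. U n * (r ^ n - r ^ Suc n)) + U N * r ^ N" for N
    by (induction N) (simp_all add: U_def algebra_simps)
  moreover have "C * ((1 - r) * ln (1 - r)) - C / N
      \<le> (\<Sum>n<N. U n * (r ^ n - r ^ Suc n)) + U N * r ^ N" for N
  proof -
    have "- C * (1 - r) * (- ln (1 - r)) \<le> - C * (1 - r) * (\<Sum>n<N. r ^ n / real n)"
      using C r sum_le_suminf[OF sums_summable[OF log], of "{..<N}"] sums_unique[OF log]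
      by (intro mult_left_mono_neg) (auto simp: mult_nonneg_nonneg)
    also have "\<dots> = (\<Sum>n<N. (- C / n) * (r ^ n - r ^ Suc n))"
      by (simp add: sum_distrib_left algebra_simps diff_divide_distrib)
    also have "\<dots> \<le> (\<Sum>n<N. U n * (r ^ n - r ^ Suc n))"
      using U r by (intro sum_mono mult_right_mono) (auto simp: mult_left_le_one_le)
    finally have 1: "C * ((1 - r) * ln (1 - r)) \<le> (\<Sum>n<N. U n * (r ^ n - r ^ Suc n))" by simp
    have "- C / N \<le> (- C / N) * r ^ N"
      using C r power_le_one[of r N] by (simp add: divide_right_mono mult_left_le)
    also have "\<dots> \<le> U N * r ^ N" using U r by (intro mult_right_mono) auto
    finally show ?thesis using 1 by simp
  qed
  ultimately have le: "C * ((1 - r) * ln (1 - r)) - C / N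
      \<le> (\<Sum>d<Suc N. \<psi> (int d) * r ^ d / real d)" for N by simp
  have "(\<lambda>N. \<Sum>d<Suc N. \<psi> (int d) * r ^ d / real d) \<longlonglongrightarrow> s"
    using f unfolding sums_def by (rule LIMSEQ_Suc)
  moreover have "(\<lambda>N. C * ((1 - r) * ln (1 - r)) - C / real N) \<longlonglongrightarrow> C * ((1 - r) * ln (1 - r)) - 0"
    by (intro tendsto_intros lim_const_over_n)
  ultimately have "C * ((1 - r) * ln (1 - r)) - 0 \<le> s"
    using le by (intro LIMSEQ_le[of _ _ _ s]) auto
  then show ?thesis by (simp add: C_def)
qed

lemma sum_mult_Legendre_nonpos:
  assumes pos: "0 < gauss_sin 1"
  shows "(\<Sum>a\<in>{1..<p}. a * \<psi> a) \<le> 0"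
proof -
  \<comment> \<open>By the logarithm series and separability, \<open>W r\<close> is
    \<open>gauss_sin 1\<close> times the power series bounded in \<open>suminf_Legendre_ge\<close>.
    As a finite sum of logarithms it has an explicit limit at 1.\<close>
  define W where "W = (\<lambda>r. \<Sum>a\<in>{1..<p}. \<psi> a * (- Im (Ln (1 - of_real r * cis (angle a)))))"
  have angle: "0 < angle a" "angle a < 2 * pi" if "a \<in> {1..<p}" for a
    using that by (auto simp: angle_def divide_less_eq)
  have "(2 * p + 1) * ((1 - r) * ln (1 - r)) \<le> W r / gauss_sin 1" if r: "0 < r" "r < 1" for r :: real
  proof (rule suminf_Legendre_ge[OF r])
    have "(\<lambda>n. \<Sum>a\<in>{1..<p}. \<psi> a * (r ^ n * sin (real n * angle a) / real n)) sums W r"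
      unfolding W_def by (intro sums_sum sums_mult sums_sin_Ln r)
    moreover have "(\<Sum>a\<in>{1..<p}. \<psi> a * (r ^ n * sin (real n * angle a) / real n))
        = \<psi> (int n) * r ^ n / real n * gauss_sin 1" for n
    proof -
      have "(\<Sum>a\<in>{1..<p}. \<psi> a * (r ^ n * sin (real n * angle a) / real n))
          = gauss_sin (int n) * r ^ n / real n"
        unfolding gauss_sin_def by (simp add: sum_distrib_left sum_divide_distrib angle_def mult_ac)
      then show ?thesis by (subst (asm) gauss_sin_separable) simp
    qed
    ultimately have "(\<lambda>n. \<psi> (int n) * r ^ n / real n * gauss_sin 1) sums W r" by simp
    then show "(\<lambda>n. \<psi> (int n) * r ^ n / real n) sums (W r / gauss_sin 1)"
      using sums_mult2_iff[of "gauss_sin 1" "\<lambda>n. \<psi> (int n) * r ^ n / real n" "W r / gauss_sin 1"] pos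
      by simp
  qed
  moreover have "eventually (\<lambda>r::real. 0 < r \<and> r < 1) (at_left 1)"
    using eventually_at_left_real[of 0 "1::real"] by simp
  ultimately have ev: "eventually (\<lambda>r. (2 * p + 1) * ((1 - r) * ln (1 - r)) \<le> W r / gauss_sin 1) (at_left 1)"
    by (auto elim: eventually_mono)
  have "((\<lambda>r::real. (1 - r) * ln (1 - r)) \<longlongrightarrow> 0) (at_left 1)" by real_asymp
  then have lim0: "((\<lambda>r::real. (2 * p + 1) * ((1 - r) * ln (1 - r))) \<longlongrightarrow> 0) (at_left 1)"
    by (rule tendsto_mult_right_zero)
  have "(W \<longlongrightarrow> (\<Sum>a\<in>{1..<p}. \<psi> a * ((pi - angle a) / 2))) (at_left 1)"
    unfolding W_def by (intro tendsto_sum tendsto_mult tendsto_const tendsto_Im_Ln_one_minus_cis angle)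
  then have "((\<lambda>r. W r / gauss_sin 1) \<longlongrightarrow> (\<Sum>a\<in>{1..<p}. \<psi> a * ((pi - angle a) / 2)) / gauss_sin 1) (at_left 1)"
    using pos by (intro tendsto_intros) auto
  from tendsto_le[OF _ this lim0 ev]
  have "0 \<le> (\<Sum>a\<in>{1..<p}. \<psi> a * ((pi - angle a) / 2)) / gauss_sin 1"
    by (simp add: trivial_limit_at_left_real)
  then have "0 \<le> (\<Sum>a\<in>{1..<p}. \<psi> a * ((pi - angle a) / 2))"
    using pos by (simp add: zero_le_divide_iff)
  also have "\<dots> = pi / 2 * (\<Sum>a\<in>{1..<p}. \<psi> a) - pi / p * (\<Sum>a\<in>{1..<p}. a * \<psi> a)"
    unfolding of_int_sum sum_distrib_left sum_subtractf[symmetric]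
    by (intro sum.cong refl) (simp add: angle_def field_simps)
  finally have "pi / p * real_of_int (\<Sum>a\<in>{1..<p}. a * \<psi> a) \<le> 0"
    by (simp add: sum_Legendre del: of_int_sum)
  then show ?thesis using p_ge_3 not_le[THEN iffD2, OF pi_gt_zero]
    by (simp add: mult_le_0_iff divide_le_0_iff del: of_int_sum)
qed

section \<open>From the weighted sum to the half sum, and small primes\<close>

abbreviation half_sum :: int where "half_sum \<equiv> \<Sum>a=1..(p - 1) div 2. \<psi> a"

text \<open>T, the sum of \<open>a * \<psi> a\<close>, is split in two ways: into \<open>a\<close>
  and \<open>p - a\<close>, and into the even numbers \<open>2 * a\<close> and the odd numbers
  \<open>p - 2 * a\<close>, always with a <= k. This gives T = 2 h - p A and \<open>\<psi> 2\<close>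
  T = 4 h - p A with A the half sum; eliminating h proves the claim.\<close>

lemma half_sum_eq: "p * half_sum = (\<psi> 2 - 2) * (\<Sum>a\<in>{1..<p}. a * \<psi> a)"
proof -
  define k where "k = (p - 1) div 2"
  have p: "p = 2 * k + 1" using p_mod_4 unfolding k_def by presburger
  define h where "h = (\<Sum>a=1..k. a * \<psi> a)"
  let ?T = "\<Sum>a\<in>{1..<p}. a * \<psi> a"
  have "?T = (\<Sum>a\<in>{1..k} \<union> (\<lambda>a. p - a) ` {1..k}. a * \<psi> a)"
  proof (rule sum.cong)
    have "x \<in> (\<lambda>a. p - a) ` {1..k}" if "x \<in> {1..<p}" "x \<notin> {1..k}" for x
      using that p by (intro image_eqI[of _ _ "p - x"]) auto
    then show "{1..<p} = {1..k} \<union> (\<lambda>a. p - a) ` {1..k}" using p by auto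
  qed simp
  also have "\<dots> = h + (\<Sum>a\<in>(\<lambda>a. p - a) ` {1..k}. a * \<psi> a)"
    unfolding h_def using p by (intro sum.union_disjoint) auto
  also have "(\<Sum>a\<in>(\<lambda>a. p - a) ` {1..k}. a * \<psi> a) = h - p * (\<Sum>a=1..k. \<psi> a)"
    by (subst sum.reindex)
      (auto simp: inj_on_def h_def Legendre_p_minus sum_distrib_left algebra_simps sum_subtractf sum_negf)
  finally have T1: "?T = 2 * h - p * (\<Sum>a=1..k. \<psi> a)" by simp
  have "?T = (\<Sum>a\<in>(*) 2 ` {1..k} \<union> (\<lambda>a. p - 2 * a) ` {1..k}. a * \<psi> a)"
  proof (rule sum.cong)
    have "x \<in> (*) 2 ` {1..k} \<union> (\<lambda>a. p - 2 * a) ` {1..k}" if "x \<in> {1..<p}" for x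
    proof (cases "even x")
      case True
      then show ?thesis using that p by (intro UnI1 image_eqI[of _ _ "x div 2"]) auto
    next
      case False
      then obtain j where "x = 2 * j + 1" by (rule oddE)
      then show ?thesis using that p by (intro UnI2 image_eqI[of _ _ "k - j"]) auto
    qed
    moreover have "(*) 2 ` {1..k} \<union> (\<lambda>a. p - 2 * a) ` {1..k} \<subseteq> {1..<p}"
      using p by auto
    ultimately show "{1..<p} = (*) 2 ` {1..k} \<union> (\<lambda>a. p - 2 * a) ` {1..k}" by blast
  qed simp
  also have "\<dots> = (\<Sum>a\<in>(*) 2 ` {1..k}. a * \<psi> a) + (\<Sum>a\<in>(\<lambda>a. p - 2 * a) ` {1..k}. a * \<psi> a)"
  proof (intro sum.union_disjoint)
    have "2 * a \<noteq> p - 2 * b" for a b using p by presburger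
    then show "(*) 2 ` {1..k} \<inter> (\<lambda>a. p - 2 * a) ` {1..k} = {}" by blast
  qed auto
  also have "(\<Sum>a\<in>(*) 2 ` {1..k}. a * \<psi> a) = \<psi> 2 * (2 * h)"
    by (subst sum.reindex) (auto simp: inj_on_def h_def Legendre_mult sum_distrib_left mult_ac)
  also have "(\<Sum>a\<in>(\<lambda>a. p - 2 * a) ` {1..k}. a * \<psi> a) = \<psi> 2 * (2 * h - p * (\<Sum>a=1..k. \<psi> a))"
    by (subst sum.reindex)
      (auto simp: inj_on_def h_def Legendre_p_minus Legendre_mult sum_distrib_left algebra_simps sum_subtractf sum_negf)
  finally have T2: "?T = \<psi> 2 * (4 * h - p * (\<Sum>a=1..k. \<psi> a))" by (simp add: algebra_simps)
  have "\<psi> 2 * \<psi> 2 = 1" using p_ge_3 by (intro Legendre_square) (auto dest: zdvd_imp_le)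
  then have "\<psi> 2 * ?T = 4 * h - p * (\<Sum>a=1..k. \<psi> a)" unfolding T2 by (simp add: mult.assoc[symmetric])
  then show ?thesis using T1 unfolding k_def[symmetric] by (simp add: left_diff_distrib)
qed

lemma odd_half_sum: "odd half_sum"
proof -
  have "even (\<psi> a + 1)" if "a \<in> {1..(p - 1) div 2}" for a
  proof -
    have "\<psi> a \<noteq> 0" using that zdvd_imp_le[of p a] by (auto simp: Legendre_eq_0_iff)
    then show ?thesis using Legendre_cases[of a] by auto
  qed
  then have "even (\<Sum>a=1..(p - 1) div 2. \<psi> a + 1)" by (rule dvd_sum)
  moreover have "(\<Sum>a=1..(p - 1) div 2. \<psi> a + 1) = half_sum + (p - 1) div 2"
    using p_ge_3 by (simp add: sum.distrib)
  moreover have "odd ((p - 1) div 2)" using p_mod_4 by presburger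
  ultimately show ?thesis by presburger
qed

text \<open>Every square found contributes 1 and every other term at least -1, so it suffices that
  \<open>Y\<close> exhibits squares for more than half of the range.\<close>

lemma half_sum_pos_if_many_squares:
  assumes sub: "(\<lambda>y. y\<^sup>2 mod p) ` Y \<subseteq> {1..(p - 1) div 2}"
    and card: "(p - 1) div 2 < 2 * int (card ((\<lambda>y. y\<^sup>2 mod p) ` Y))"
  shows "0 < half_sum"
proof -
  define R where "R = (\<lambda>y. y\<^sup>2 mod p) ` Y"
  let ?H = "{1..(p - 1) div 2}"
  have fin: "finite R" using sub finite_subset unfolding R_def by blast
  have "\<psi> a = 1" if "a \<in> R" for a
  proof -
    from that obtain y where y: "a = y\<^sup>2 mod p" by (auto simp: R_def)
    have "a \<in> ?H" using that sub unfolding R_def by blast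
    then have "\<not> p dvd a" using zdvd_imp_le[of p a] by auto
    moreover have "QuadRes p a" unfolding QuadRes_def y by (intro exI[of _ y]) (simp add: Cong.cong_def)
    ultimately show ?thesis by (simp add: Legendre_def cong_0_iff)
  qed
  then have "(\<Sum>a\<in>R. \<psi> a) = int (card R)" by simp
  moreover have "(\<Sum>a\<in>?H - R. \<psi> a) \<ge> (\<Sum>a\<in>?H - R. - 1)"
    using abs_Legendre_le_1 by (intro sum_mono) (simp add: abs_le_iff minus_le_iff)
  moreover have "card (?H - R) = card ?H - card R"
    using sub fin by (simp add: R_def card_Diff_subset)
  moreover have "card R \<le> card ?H"
    using sub unfolding R_def by (intro card_mono) auto
  moreover have "half_sum = (\<Sum>a\<in>?H - R. \<psi> a) + (\<Sum>a\<in>R. \<psi> a)"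
    using sub by (intro sum.subset_diff) (auto simp: R_def)
  ultimately show ?thesis using card p_ge_3 unfolding R_def[symmetric] by (simp add: of_nat_diff)
qed

lemma half_sum_pos: "0 < half_sum"
proof (cases "25 \<le> p")
  case True
  have "0 \<le> (\<psi> 2 - 2) * (\<Sum>a\<in>{1..<p}. a * \<psi> a)"
    using sum_mult_Legendre_nonpos[OF gauss_sin_pos[OF True]] abs_Legendre_le_1[of 2]
    by (intro mult_nonpos_nonpos) auto
  then have "0 \<le> half_sum" unfolding half_sum_eq[symmetric] using p_ge_3 by (simp add: zero_le_mult_iff)
  then show ?thesis using odd_half_sum by (cases "half_sum = 0") auto
next
  case False
  \<comment> \<open>Of the positive integers below 25 that are 3 modulo 4, only 15 is
    composite.\<close>
  have "\<not> prime (15 :: int)"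
    using prime_int_not_dvd[of 15 3] by auto
  then have "p \<noteq> 15" using prime_p by blast
  moreover have "p = 3 \<or> p = 7 \<or> p = 11 \<or> p = 15 \<or> p = 19 \<or> p = 23"
    using False p_ge_3 p_mod_4 by presburger
  ultimately consider "p = 3" | "p = 7" | "p = 11" | "p = 19" | "p = 23" by blast
  then show ?thesis
  proof cases
    case 1
    \<comment> \<open>In each case the set lists numbers whose squares reduce to distinct residues
      below p/2; for \<open>p = 23\<close>, for instance, these are 1, 4, 9, 2, 3, 8, 6.\<close>
    show ?thesis by (rule half_sum_pos_if_many_squares[of "{1}"]) (simp_all add: 1)
  next
    case 2
    show ?thesis by (rule half_sum_pos_if_many_squares[of "{1, 3}"]) (simp_all add: 2)
  next
    case 3
    show ?thesis by (rule half_sum_pos_if_many_squares[of "{1, 2, 4, 5}"]) (simp_all add: 3)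
  next
    case 4
    show ?thesis by (rule half_sum_pos_if_many_squares[of "{1, 2, 3, 5, 8, 9}"]) (simp_all add: 4)
  next
    case 5
    show ?thesis by (rule half_sum_pos_if_many_squares[of "{1, 2, 3, 5, 7, 10, 11}"]) (simp_all add: 5)
  qed
qed

end

theorem mainTheorem1:
  fixes p :: int
  assumes "prime p" and "odd p" and "[p = 3] (mod 4)"
  shows "(\<Sum>a = 1..(p - 1) div 2. Legendre a p) > 0"
  using assms by (intro prime_3_mod_4.half_sum_pos prime_3_mod_4.intro)

end
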